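(* Let $\mathfrak g$ be a Lie algebra and let $\mathbf r=\{r^{(c)}\}_{c\in C}\subset\mathfrak g\otimes\mathfrak g$ be such that $r^{(c)}+r^{(c)}_{2,1}$ is $\mathfrak g$-invariant for every $c\in C$. Then for any $\mathbf c=(c_{i,j}):[n]\times[n]\to C$, the element $\mathbf r^{(\mathbf c)}+(\mathbf r^{(\mathbf c)})^{op}$, where $$\mathbf r^{(\mathbf c)}=\sum_{1\le i,j\le n}(r^{(c_{i,j})})_{j,i+n}\in\mathfrak g^{\oplus n}\otimes\mathfrak g^{\oplus n},$$ is $\mathfrak g^{\oplus n}$-invariant if and only if $r^{(c_{i,k})}+\tau(r^{(c_{k,i})})\in\mathfrak z(\mathfrak g)\otimes\mathfrak z(\mathfrak g)$ for all $1\le i<k\le n$, where $\mathfrak z(\mathfrak g)$ is the center of $\mathfrak g$.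
   Context: The base field has characteristic zero; $[n]=\{1,\dots,n\}$. $\tau$ is the flip of tensor factors and $r_{2,1}=\tau(r)$. For a Lie algebra $\mathfrak l$, an element of $\mathfrak l\otimes\mathfrak l$ is $\mathfrak l$-invariant if it is annihilated by the diagonal adjoint action of $\mathfrak l$. $U(\mathfrak g^{\oplus n})$ is identified with $U(\mathfrak g)^{\otimes n}$, so $\mathfrak g^{\oplus n}\otimes\mathfrak g^{\oplus n}\subset U(\mathfrak g)^{\otimes2n}$ with positions $1,\dots,n$ for the first factor and $n+1,\dots,2n$ for the second; for $x=\sum_t a_t\otimes b_t\in\mathfrak g\otimes\mathfrak g$ and distinct $i,j\in\{1,\dots,2n\}$, $x_{i,j}\in U(\mathfrak g)^{\otimes2n}$ has $a_t$ in position $i$, $b_t$ in position $j$ and $1$ elsewhere (summed over $t$). For $X\in\mathfrak g^{\oplus n}\otimes\mathfrak g^{\oplus n}$, $X^{op}$ is the flip of its two factors. *)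

theory Defs
  imports "HOL-Analysis.Finite_Cartesian_Product" "HOL-Library.Poly_Mapping"
begin

section \<open>Lie algebras\<close>

locale lie_algebra = vector_space smul
  for smul :: "'k::field_char_0 \<Rightarrow> 'a::ab_group_add \<Rightarrow> 'a" +
  fixes bracket :: "'a \<Rightarrow> 'a \<Rightarrow> 'a"
  assumes bracket_add_left: "bracket (x + y) z = bracket x z + bracket y z"
    and bracket_add_right: "bracket x (y + z) = bracket x y + bracket x z"
    and bracket_scale_left: "bracket (smul t x) y = smul t (bracket x y)"
    and bracket_scale_right: "bracket x (smul t y) = smul t (bracket x y)"
    and bracket_self: "bracket x x = 0"
    and jacobi: "bracket x (bracket y z) + bracket y (bracket z x) + bracket z (bracket x y) = 0"

definition lie_center :: "('a \<Rightarrow> 'a \<Rightarrow> 'a::zero) \<Rightarrow> 'a set" where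
  "lie_center bracket = {z. \<forall>x. bracket x z = 0}"

text \<open>The direct sum of copies of a Lie algebra indexed by a finite type \<open>'n\<close>. For the index set
  \<open>[n]\<close> with its order, \<open>'n\<close> is an arbitrary finite linearly ordered type.\<close>

definition dsum_scale :: "('k \<Rightarrow> 'a \<Rightarrow> 'a) \<Rightarrow> 'k \<Rightarrow> 'a ^ 'n \<Rightarrow> 'a ^ 'n" where
  "dsum_scale smul t x = (\<chi> i. smul t (x $ i))"

definition dsum_bracket :: "('a \<Rightarrow> 'a \<Rightarrow> 'a) \<Rightarrow> 'a ^ 'n \<Rightarrow> 'a ^ 'n \<Rightarrow> 'a ^ 'n" where
  "dsum_bracket bracket x y = (\<chi> i. bracket (x $ i) (y $ i))"

lemma lie_algebra_dsum:
  fixes smul :: "'k::field_char_0 \<Rightarrow> 'a::ab_group_add \<Rightarrow> 'a"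
  assumes "lie_algebra smul bracket"
  shows "lie_algebra (dsum_scale smul :: 'k \<Rightarrow> 'a ^ 'n \<Rightarrow> 'a ^ 'n) (dsum_bracket bracket)"
proof -
  interpret lie_algebra smul bracket by fact
  show ?thesis
    by unfold_locales
      (simp_all add: vec_eq_iff dsum_scale_def dsum_bracket_def scale_right_distrib
        scale_left_distrib bracket_add_left bracket_add_right bracket_scale_left
        bracket_scale_right bracket_self jacobi)
qed

section \<open>The tensor square of a vector space\<close>

text \<open>
  Elements of the free vector space on \<open>V \<times> V\<close> are finitely supported functions.
  The tensor square is its quotient by the subspace generated by the bilinearity relations;
  its elements are represented as cosets, of type \<open>('k, 'a) tensor\<close>.
  The set of all cosets is \<open>tensor_space smul\<close>; other sets of formal sums are junk.
\<close>

type_synonym ('k, 'a) formal = "('a \<times> 'a) \<Rightarrow>\<^sub>0 'k"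
type_synonym ('k, 'a) tensor = "('k, 'a) formal set"

definition formal_scale :: "'k::field \<Rightarrow> ('k, 'a) formal \<Rightarrow> ('k, 'a) formal" where
  "formal_scale t x = Poly_Mapping.map ((*) t) x"

definition bilinear_relations :: "('k::field \<Rightarrow> 'a::ab_group_add \<Rightarrow> 'a) \<Rightarrow> ('k, 'a) formal set" where
  "bilinear_relations smul =
     {Poly_Mapping.single (a + a', b) 1 - Poly_Mapping.single (a, b) 1
        - Poly_Mapping.single (a', b) 1 | a a' b. True} \<union>
     {Poly_Mapping.single (a, b + b') 1 - Poly_Mapping.single (a, b) 1
        - Poly_Mapping.single (a, b') 1 | a b b'. True} \<union>
     {Poly_Mapping.single (smul t a, b) 1 - Poly_Mapping.single (a, b) t | t a b. True} \<union>
     {Poly_Mapping.single (a, smul t b) 1 - Poly_Mapping.single (a, b) t | t a b. True}"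

definition tensor_kernel :: "('k::field \<Rightarrow> 'a::ab_group_add \<Rightarrow> 'a) \<Rightarrow> ('k, 'a) formal set" where
  "tensor_kernel smul = module.span formal_scale (bilinear_relations smul)"

definition tensor_class ::
    "('k::field \<Rightarrow> 'a::ab_group_add \<Rightarrow> 'a) \<Rightarrow> ('k, 'a) formal \<Rightarrow> ('k, 'a) tensor" where
  "tensor_class smul x = {y. y - x \<in> tensor_kernel smul}"

definition tensor_space :: "('k::field \<Rightarrow> 'a::ab_group_add \<Rightarrow> 'a) \<Rightarrow> ('k, 'a) tensor set" where
  "tensor_space smul = range (tensor_class smul)"

text \<open>
  Operations on cosets are defined through an arbitrary representative. The lemmas at the end
  of this section show that the results do not depend on it.
\<close>

definition tensor_rep :: "('k, 'a) tensor \<Rightarrow> ('k, 'a) formal" where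
  "tensor_rep X = (SOME x. x \<in> X)"

definition tensor_zero :: "('k::field \<Rightarrow> 'a::ab_group_add \<Rightarrow> 'a) \<Rightarrow> ('k, 'a) tensor" where
  "tensor_zero smul = tensor_class smul 0"

definition tensor_add :: "('k::field \<Rightarrow> 'a::ab_group_add \<Rightarrow> 'a)
    \<Rightarrow> ('k, 'a) tensor \<Rightarrow> ('k, 'a) tensor \<Rightarrow> ('k, 'a) tensor" where
  "tensor_add smul X Y = tensor_class smul (tensor_rep X + tensor_rep Y)"

definition tensor_sum :: "('k::field \<Rightarrow> 'a::ab_group_add \<Rightarrow> 'a)
    \<Rightarrow> ('i \<Rightarrow> ('k, 'a) tensor) \<Rightarrow> 'i set \<Rightarrow> ('k, 'a) tensor" where
  "tensor_sum smul X I = tensor_class smul (\<Sum>i\<in>I. tensor_rep (X i))"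

text \<open>The linear extension of a map \<open>h\<close> on generators \<open>(a, b)\<close>.\<close>

definition formal_map :: "('a \<times> 'a \<Rightarrow> 'b \<times> 'b) \<Rightarrow> ('k::field, 'a) formal \<Rightarrow> ('k, 'b) formal" where
  "formal_map h x =
     (\<Sum>p\<in>Poly_Mapping.keys x. Poly_Mapping.single (h p) (Poly_Mapping.lookup x p))"

text \<open>\<open>f \<otimes> g\<close> for linear maps \<open>f, g : V \<rightarrow> W\<close>; the argument \<open>smul\<close> is that of the codomain \<open>W\<close>.\<close>

definition tensor_map :: "('k::field \<Rightarrow> 'b::ab_group_add \<Rightarrow> 'b)
    \<Rightarrow> ('a \<Rightarrow> 'b) \<Rightarrow> ('a \<Rightarrow> 'b) \<Rightarrow> ('k, 'a) tensor \<Rightarrow> ('k, 'b) tensor" where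
  "tensor_map smul f g X = tensor_class smul (formal_map (map_prod f g) (tensor_rep X))"

definition tensor_flip :: "('k::field \<Rightarrow> 'a::ab_group_add \<Rightarrow> 'a)
    \<Rightarrow> ('k, 'a) tensor \<Rightarrow> ('k, 'a) tensor" where
  "tensor_flip smul X = tensor_class smul (formal_map prod.swap (tensor_rep X))"

text \<open>The canonical image of \<open>S \<otimes> T\<close> in \<open>V \<otimes> V\<close>, for subspaces \<open>S\<close> and \<open>T\<close> of \<open>V\<close>.\<close>

definition tensor_subspaces :: "('k::field \<Rightarrow> 'a::ab_group_add \<Rightarrow> 'a)
    \<Rightarrow> 'a set \<Rightarrow> 'a set \<Rightarrow> ('k, 'a) tensor set" where
  "tensor_subspaces smul S T = tensor_class smul ` {x. Poly_Mapping.keys x \<subseteq> S \<times> T}"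

subsection \<open>Independence of representatives\<close>

lemma lookup_formal_scale: "Poly_Mapping.lookup (formal_scale t x) p = t * Poly_Mapping.lookup x p"
  by (simp add: formal_scale_def Poly_Mapping.map.rep_eq when_def)

lemma vector_space_formal: "vector_space (formal_scale :: 'k::field \<Rightarrow> ('k, 'a) formal \<Rightarrow> _)"
  by unfold_locales
    (auto intro!: poly_mapping_eqI simp: lookup_formal_scale lookup_add algebra_simps)

interpretation formal: vector_space "formal_scale :: 'k::field \<Rightarrow> ('k, 'a) formal \<Rightarrow> _"
  by (rule vector_space_formal)

lemma tensor_class_eq_iff:
  "tensor_class smul x = tensor_class smul y \<longleftrightarrow> x - y \<in> tensor_kernel smul"
proof
  assume "tensor_class smul x = tensor_class smul y"
  moreover have "x \<in> tensor_class smul x"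
    by (simp add: tensor_class_def tensor_kernel_def formal.span_zero)
  ultimately show "x - y \<in> tensor_kernel smul" by (simp add: tensor_class_def)
next
  assume *: "x - y \<in> tensor_kernel smul"
  have "z - x \<in> tensor_kernel smul \<longleftrightarrow> z - y \<in> tensor_kernel smul" for z
    using formal.span_add[of "z - x" "bilinear_relations smul" "x - y"]
      formal.span_diff[of "z - y" "bilinear_relations smul" "x - y"] *
    by (auto simp: tensor_kernel_def)
  then show "tensor_class smul x = tensor_class smul y"
    by (auto simp: tensor_class_def)
qed

lemma tensor_rep_class: "tensor_rep (tensor_class smul x) - x \<in> tensor_kernel smul"
proof -
  have "x \<in> tensor_class smul x"
    by (simp add: tensor_class_def tensor_kernel_def formal.span_zero)
  then have "tensor_rep (tensor_class smul x) \<in> tensor_class smul x"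
    unfolding tensor_rep_def by (rule someI)
  then show ?thesis by (simp add: tensor_class_def)
qed

lemma tensor_add_class:
  "tensor_add smul (tensor_class smul x) (tensor_class smul y) = tensor_class smul (x + y)"
  unfolding tensor_add_def tensor_class_eq_iff
  using formal.span_add[OF tensor_rep_class[of smul x, unfolded tensor_kernel_def]
      tensor_rep_class[of smul y, unfolded tensor_kernel_def]]
  by (simp add: tensor_kernel_def algebra_simps)

lemma tensor_sum_class:
  "tensor_sum smul (\<lambda>i. tensor_class smul (x i)) I = tensor_class smul (\<Sum>i\<in>I. x i)"
  unfolding tensor_sum_def tensor_class_eq_iff sum_subtractf[symmetric]
  using tensor_rep_class[of smul] by (simp add: tensor_kernel_def formal.span_sum)

lemma formal_map_superset:
  assumes "finite A" "Poly_Mapping.keys x \<subseteq> A"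
  shows "formal_map h x =
    (\<Sum>p\<in>A. Poly_Mapping.single (h p) (Poly_Mapping.lookup x p))"
  unfolding formal_map_def
  by (rule sum.mono_neutral_left) (use assms in \<open>auto simp: in_keys_iff\<close>)

lemma formal_map_single [simp]:
  "formal_map h (Poly_Mapping.single p t) = Poly_Mapping.single (h p) t"
  by (subst formal_map_superset[of "{p}"]) auto

lemma linear_formal_map:
  fixes h :: "'a \<times> 'a \<Rightarrow> 'b \<times> 'b"
  shows "Vector_Spaces.linear (formal_scale :: 'k::field \<Rightarrow> _) formal_scale (formal_map h)"
proof unfold_locales
  fix x y :: "('k::field, 'a) formal"
  let ?A = "Poly_Mapping.keys x \<union> Poly_Mapping.keys y"
  show "formal_map h (x + y) = formal_map h x + formal_map h y"
    by (subst (1 2 3) formal_map_superset[of ?A])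
      (use Poly_Mapping.keys_add[of x y] in
        \<open>auto simp: lookup_add single_add sum.distrib\<close>)
next
  fix t :: 'k and x :: "('k::field, 'a) formal"
  have *: "Poly_Mapping.single q (t * u) = formal_scale t (Poly_Mapping.single q u)"
    for q :: "'b \<times> 'b" and u
    by (rule poly_mapping_eqI) (simp add: lookup_formal_scale lookup_single when_def)
  show "formal_map h (formal_scale t x) = formal_scale t (formal_map h x)"
    by (subst (1 2) formal_map_superset[of "Poly_Mapping.keys x"])
      (auto simp: lookup_formal_scale in_keys_iff * formal.scale_sum_right)
qed

lemma formal_map_class:
  assumes "\<And>x. x \<in> bilinear_relations smul \<Longrightarrow> formal_map h x \<in> tensor_kernel smul'"
  shows "tensor_class smul' (formal_map h (tensor_rep (tensor_class smul x)))
    = tensor_class smul' (formal_map h x)"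
proof -
  interpret h: Vector_Spaces.linear formal_scale formal_scale "formal_map h"
    by (rule linear_formal_map)
  have "formal_map h ` tensor_kernel smul \<subseteq> tensor_kernel smul'"
    unfolding tensor_kernel_def h.span_image[symmetric]
    by (rule formal.span_minimal)
      (use assms formal.subspace_span in \<open>auto simp: tensor_kernel_def\<close>)
  then show ?thesis
    using tensor_rep_class[of smul x] by (auto simp: tensor_class_eq_iff h.diff[symmetric])
qed

lemma bilinear_relations_kernel: "x \<in> bilinear_relations smul \<Longrightarrow> x \<in> tensor_kernel smul"
  by (simp add: tensor_kernel_def formal.span_base)

lemma tensor_map_class:
  assumes "Vector_Spaces.linear smul smul' f" "Vector_Spaces.linear smul smul' g"
  shows "tensor_map smul' f g (tensor_class smul x)
    = tensor_class smul' (formal_map (map_prod f g) x)"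
proof -
  interpret f: Vector_Spaces.linear smul smul' f by fact
  interpret g: Vector_Spaces.linear smul smul' g by fact
  interpret h: Vector_Spaces.linear formal_scale formal_scale "formal_map (map_prod f g)"
    by (rule linear_formal_map)
  show ?thesis
    unfolding tensor_map_def
    by (rule formal_map_class, rule bilinear_relations_kernel)
      (auto simp: bilinear_relations_def h.diff f.add f.scale g.add g.scale; blast)
qed

lemma tensor_flip_class:
  "tensor_flip smul (tensor_class smul x) = tensor_class smul (formal_map prod.swap x)"
proof -
  interpret h: Vector_Spaces.linear formal_scale formal_scale "formal_map prod.swap"
    by (rule linear_formal_map)
  show ?thesis
    unfolding tensor_flip_def
    by (rule formal_map_class, rule bilinear_relations_kernel)
      (auto simp: bilinear_relations_def h.diff; blast)
qed

section \<open>Invariance and the element \<open>r\<^sup>(\<^sup>c\<^sup>)\<close>\<close>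

definition ad_tensor :: "('k::field \<Rightarrow> 'a::ab_group_add \<Rightarrow> 'a) \<Rightarrow> ('a \<Rightarrow> 'a \<Rightarrow> 'a)
    \<Rightarrow> 'a \<Rightarrow> ('k, 'a) tensor \<Rightarrow> ('k, 'a) tensor" where
  "ad_tensor smul bracket x X =
     tensor_add smul (tensor_map smul (bracket x) id X) (tensor_map smul id (bracket x) X)"

definition lie_invariant :: "('k::field \<Rightarrow> 'a::ab_group_add \<Rightarrow> 'a) \<Rightarrow> ('a \<Rightarrow> 'a \<Rightarrow> 'a)
    \<Rightarrow> ('k, 'a) tensor \<Rightarrow> bool" where
  "lie_invariant smul bracket X \<longleftrightarrow> (\<forall>x. ad_tensor smul bracket x X = tensor_zero smul)"

text \<open>
  For \<open>x = \<Sum> a\<^sub>t \<otimes> b\<^sub>t\<close>, the element \<open>x\<^bsub>j,i+n\<^esub>\<close> of \<open>U(\<gg>)\<^bsup>\<otimes>2n\<^esup>\<close> has \<open>a\<^sub>t\<close> in position \<open>j\<close> of the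
  first block of \<open>n\<close> factors and \<open>b\<^sub>t\<close> in position \<open>i\<close> of the second block. Under the
  identification of each block with \<open>U(\<gg>\<^bsup>\<oplus>n\<^esup>)\<close> it is \<open>\<Sum> \<iota>\<^sub>j(a\<^sub>t) \<otimes> \<iota>\<^sub>i(b\<^sub>t)\<close>, where \<open>\<iota>\<^sub>k = axis k\<close> is
  the inclusion of the \<open>k\<close>-th summand of \<open>\<gg>\<^bsup>\<oplus>n\<^esup>\<close>.
\<close>

definition two_block_place :: "('k::field \<Rightarrow> 'a::ab_group_add \<Rightarrow> 'a) \<Rightarrow> 'n \<Rightarrow> 'n
    \<Rightarrow> ('k, 'a) tensor \<Rightarrow> ('k, 'a ^ 'n) tensor" where
  "two_block_place smul j i X = tensor_map (dsum_scale smul) (axis j) (axis i) X"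

definition r_family :: "('k::field \<Rightarrow> 'a::ab_group_add \<Rightarrow> 'a) \<Rightarrow> ('c \<Rightarrow> ('k, 'a) tensor)
    \<Rightarrow> ('n \<Rightarrow> 'n \<Rightarrow> 'c) \<Rightarrow> ('k, 'a ^ 'n) tensor" where
  "r_family smul r c =
     tensor_sum (dsum_scale smul) (\<lambda>(i, j). two_block_place smul j i (r (c i j))) UNIV"

end

theory Submission
  imports Defs
begin

text \<open>
  Write \<open>\<iota>\<^sub>k\<close> for the inclusion of the \<open>k\<close>-th summand and
  \<open>t\<^sub>i\<^sub>j = r\<^bsup>(c i j)\<^esup> + \<tau>(r\<^bsup>(c j i)\<^esup>)\<close>. The element in question is \<open>\<Sum>\<^sub>i\<^sub>j (\<iota>\<^sub>j \<otimes> \<iota>\<^sub>i) t\<^sub>i\<^sub>j\<close>,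
  and \<open>X\<close> sends it to \<open>\<Sum>\<^sub>i\<^sub>j (\<iota>\<^sub>j \<otimes> \<iota>\<^sub>i) (ad X\<^sub>j \<otimes> 1 + 1 \<otimes> ad X\<^sub>i) t\<^sub>i\<^sub>j\<close>. Projecting to the
  blocks, this vanishes for all \<open>X\<close> iff each block does. The diagonal blocks vanish by
  hypothesis. Off the diagonal \<open>X\<^sub>i\<close> and \<open>X\<^sub>j\<close> are independent, so the condition says that
  \<open>t\<^sub>i\<^sub>j\<close> is killed by all \<open>ad u \<otimes> 1\<close> and all \<open>1 \<otimes> ad v\<close>. Expanding one tensor factor in a
  basis and comparing coefficients, this puts \<open>t\<^sub>i\<^sub>j\<close> into \<open>\<zz> \<otimes> \<zz>\<close>. Since
  \<open>t\<^sub>j\<^sub>i = \<tau>(t\<^sub>i\<^sub>j)\<close>, the pairs \<open>i < j\<close> suffice.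
\<close>

section \<open>Formal sums modulo the bilinearity relations\<close>

lemma formal_map_0 [simp]: "formal_map h 0 = 0"
  by (simp add: formal_map_def)

lemma formal_map_add: "formal_map h (x + y) = formal_map h x + formal_map h y"
proof -
  interpret h: Vector_Spaces.linear formal_scale formal_scale "formal_map h"
    by (rule linear_formal_map)
  show ?thesis by (rule h.add)
qed

lemma formal_map_diff: "formal_map h (x - y) = formal_map h x - formal_map h y"
proof -
  interpret h: Vector_Spaces.linear formal_scale formal_scale "formal_map h"
    by (rule linear_formal_map)
  show ?thesis by (rule h.diff)
qed

lemma formal_map_sum: "formal_map h (sum f A) = (\<Sum>a\<in>A. formal_map h (f a))"
proof -
  interpret h: Vector_Spaces.linear formal_scale formal_scale "formal_map h"
    by (rule linear_formal_map)
  show ?thesis by (rule h.sum)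
qed

lemma formal_eq_sum_single:
  "x = (\<Sum>p\<in>Poly_Mapping.keys x. Poly_Mapping.single p (Poly_Mapping.lookup x p))"
  by (rule poly_mapping_eqI) (auto simp: lookup_sum lookup_single when_def in_keys_iff)

lemma formal_map_id [simp]: "formal_map id x = x"
  using formal_eq_sum_single[of x] by (simp add: formal_map_def)

lemma formal_map_comp: "formal_map g (formal_map h x) = formal_map (g \<circ> h) x"
  unfolding formal_map_def[of h x] by (simp add: formal_map_sum formal_map_def[of "g \<circ> h" x])

lemma keys_formal_map_subset: "Poly_Mapping.keys (formal_map h x) \<subseteq> h ` Poly_Mapping.keys x"
  unfolding formal_map_def
  by (rule order.trans[OF Poly_Mapping.keys_sum]) (auto split: if_splits)

lemma formal_map_swap_map_prod:
  "formal_map prod.swap (formal_map (map_prod f g) x) =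
    formal_map (map_prod g f) (formal_map prod.swap x)"
  unfolding formal_map_comp by (rule arg_cong[where f = "\<lambda>h. formal_map h x"]) auto

lemma formal_map_swap_swap [simp]: "formal_map prod.swap (formal_map prod.swap x) = x"
  by (simp add: formal_map_comp)

section \<open>The relation subspace and the maps that preserve it\<close>

lemma kernel_0 [simp]: "0 \<in> tensor_kernel smul"
  by (simp add: tensor_kernel_def formal.span_zero)

lemma kernel_add: "x \<in> tensor_kernel smul \<Longrightarrow> y \<in> tensor_kernel smul \<Longrightarrow> x + y \<in> tensor_kernel smul"
  by (simp add: tensor_kernel_def formal.span_add)

lemma kernel_diff: "x \<in> tensor_kernel smul \<Longrightarrow> y \<in> tensor_kernel smul \<Longrightarrow> x - y \<in> tensor_kernel smul"
  by (simp add: tensor_kernel_def formal.span_diff)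

lemma kernel_scale: "x \<in> tensor_kernel smul \<Longrightarrow> formal_scale t x \<in> tensor_kernel smul"
  by (simp add: tensor_kernel_def formal.span_scale)

lemma kernel_sum: "(\<And>a. a \<in> A \<Longrightarrow> f a \<in> tensor_kernel smul) \<Longrightarrow> sum f A \<in> tensor_kernel smul"
  by (simp add: tensor_kernel_def formal.span_sum)

lemma kernel_diff_iff:
  assumes "x - y \<in> tensor_kernel smul"
  shows "x \<in> tensor_kernel smul \<longleftrightarrow> y \<in> tensor_kernel smul"
  using kernel_add[OF assms, of y] kernel_diff[of x smul "x - y"] assms by auto

text \<open>This replaces each genuine tensor by a formal sum, so that all later equalities become
  memberships in \<open>tensor_kernel\<close>.\<close>

lemma tensor_class_rep:
  assumes "X \<in> tensor_space smul"
  shows "tensor_class smul (tensor_rep X) = X"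
proof -
  obtain x where "X = tensor_class smul x" using assms by (auto simp: tensor_space_def)
  then show ?thesis using tensor_rep_class[of smul x] by (simp only: tensor_class_eq_iff)
qed

text \<open>Since the map induced by \<open>f\<close> and \<open>g\<close> on cosets is well
  defined, a representative of zero must go to a representative of zero.\<close>

lemma formal_map_kernel:
  assumes "Vector_Spaces.linear smul smul' f" "Vector_Spaces.linear smul smul' g"
    and "x \<in> tensor_kernel smul"
  shows "formal_map (map_prod f g) x \<in> tensor_kernel smul'"
proof -
  have "tensor_class smul x = tensor_class smul 0"
    using assms(3) by (simp add: tensor_class_eq_iff)
  then have "tensor_class smul' (formal_map (map_prod f g) x) = tensor_class smul' 0"
    using tensor_map_class[OF assms(1,2)] by (metis formal_map_0)
  then show ?thesis by (simp add: tensor_class_eq_iff)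
qed

lemma formal_map_swap_kernel:
  assumes "x \<in> tensor_kernel smul"
  shows "formal_map prod.swap x \<in> tensor_kernel smul"
proof -
  have "tensor_class smul x = tensor_class smul 0"
    using assms by (simp add: tensor_class_eq_iff)
  then have "tensor_class smul (formal_map prod.swap x) = tensor_class smul 0"
    using tensor_flip_class by (metis formal_map_0)
  then show ?thesis by (simp add: tensor_class_eq_iff)
qed

section \<open>Bilinearity of generators with arbitrary coefficients\<close>

lemma formal_scale_single:
  "formal_scale t (Poly_Mapping.single p u) = Poly_Mapping.single p (t * u)"
  by (rule poly_mapping_eqI) (simp add: lookup_formal_scale lookup_single when_def)

lemma single_add_left_kernel:
  "Poly_Mapping.single (a + a', b) t - Poly_Mapping.single (a, b) t
    - Poly_Mapping.single (a', b) t \<in> tensor_kernel smul"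
proof -
  have "Poly_Mapping.single (a + a', b) 1 - Poly_Mapping.single (a, b) 1
      - Poly_Mapping.single (a', b) 1 \<in> tensor_kernel smul"
    by (rule bilinear_relations_kernel, unfold bilinear_relations_def) blast
  from kernel_scale[OF this, of t] show ?thesis
    by (simp add: formal.scale_right_diff_distrib formal_scale_single)
qed

lemma single_add_right_kernel:
  "Poly_Mapping.single (a, b + b') t - Poly_Mapping.single (a, b) t
    - Poly_Mapping.single (a, b') t \<in> tensor_kernel smul"
proof -
  have "Poly_Mapping.single (a, b + b') 1 - Poly_Mapping.single (a, b) 1
      - Poly_Mapping.single (a, b') 1 \<in> tensor_kernel smul"
    by (rule bilinear_relations_kernel, unfold bilinear_relations_def) blast
  from kernel_scale[OF this, of t] show ?thesis
    by (simp add: formal.scale_right_diff_distrib formal_scale_single)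
qed

lemma single_scale_left_kernel:
  "Poly_Mapping.single (smul s a, b) t - Poly_Mapping.single (a, b) (t * s) \<in> tensor_kernel smul"
proof -
  have "Poly_Mapping.single (smul s a, b) 1 - Poly_Mapping.single (a, b) s \<in> tensor_kernel smul"
    by (rule bilinear_relations_kernel, unfold bilinear_relations_def) blast
  from kernel_scale[OF this, of t] show ?thesis
    by (simp add: formal.scale_right_diff_distrib formal_scale_single)
qed

lemma single_scale_right_kernel:
  "Poly_Mapping.single (a, smul s b) t - Poly_Mapping.single (a, b) (t * s) \<in> tensor_kernel smul"
proof -
  have "Poly_Mapping.single (a, smul s b) 1 - Poly_Mapping.single (a, b) s \<in> tensor_kernel smul"
    by (rule bilinear_relations_kernel, unfold bilinear_relations_def) blast
  from kernel_scale[OF this, of t] show ?thesis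
    by (simp add: formal.scale_right_diff_distrib formal_scale_single)
qed

text \<open>In the additivity relation for \<open>0 + 0\<close>, one generator cancels and the
  negative of the generator remains.\<close>

lemma single_0_left_kernel: "Poly_Mapping.single (0, b) t \<in> tensor_kernel smul"
  using kernel_diff[OF kernel_0 single_add_left_kernel[of 0 0 b t smul]] by simp

lemma single_0_right_kernel: "Poly_Mapping.single (a, 0) t \<in> tensor_kernel smul"
  using kernel_diff[OF kernel_0 single_add_right_kernel[of a 0 0 t smul]] by simp

lemma single_sum_left_kernel:
  "Poly_Mapping.single (\<Sum>i\<in>I. f i, b) t - (\<Sum>i\<in>I. Poly_Mapping.single (f i, b) t)
    \<in> tensor_kernel smul"
proof (induction I rule: infinite_finite_induct)
  case (insert i I)
  then show ?case
    using kernel_add[OF single_add_left_kernel[of "f i" "sum f I" b t smul] insert.IH]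
    by (simp add: algebra_simps)
\<comment> \<open>A sum over an infinite index set is 0 by convention, so that case, like the empty
  one, leaves a generator with a zero factor.\<close>
qed (simp_all add: single_0_left_kernel)

lemma single_sum_right_kernel:
  "Poly_Mapping.single (a, \<Sum>i\<in>I. f i) t - (\<Sum>i\<in>I. Poly_Mapping.single (a, f i) t)
    \<in> tensor_kernel smul"
proof (induction I rule: infinite_finite_induct)
  case (insert i I)
  then show ?case
    using kernel_add[OF single_add_right_kernel[of a "f i" "sum f I" t smul] insert.IH]
    by (simp add: algebra_simps)
qed (simp_all add: single_0_right_kernel)

lemma formal_map_zero_kernel:
  assumes "\<And>a b. (a, b) \<in> Poly_Mapping.keys x \<Longrightarrow> f a = 0 \<or> g b = 0"
  shows "formal_map (map_prod f g) x \<in> tensor_kernel smul"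
  unfolding formal_map_def
proof (rule kernel_sum)
  fix p assume "p \<in> Poly_Mapping.keys x"
  then have "f (fst p) = 0 \<or> g (snd p) = 0" using assms by (cases p) auto
  then show "Poly_Mapping.single (map_prod f g p) (Poly_Mapping.lookup x p) \<in> tensor_kernel smul"
    by (cases p) (auto simp: single_0_left_kernel single_0_right_kernel)
qed

section \<open>Coefficients with respect to a basis of one factor\<close>

text \<open>For linear \<open>\<phi>\<close> this is \<open>\<phi> \<otimes> id\<close> followed by
  the identification of \<open>k \<otimes> V\<close> with \<open>V\<close>, written on formal
  sums.\<close>

definition contract :: "('k::field \<Rightarrow> 'a::ab_group_add \<Rightarrow> 'a) \<Rightarrow> ('a \<Rightarrow> 'k)
    \<Rightarrow> ('k, 'a) formal \<Rightarrow> 'a" where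
  "contract smul \<phi> x =
     (\<Sum>p\<in>Poly_Mapping.keys x. smul (Poly_Mapping.lookup x p * \<phi> (fst p)) (snd p))"

context vector_space
begin

lemma contract_superset:
  assumes "finite A" "Poly_Mapping.keys x \<subseteq> A"
  shows "contract scale \<phi> x = (\<Sum>p\<in>A. scale (Poly_Mapping.lookup x p * \<phi> (fst p)) (snd p))"
  unfolding contract_def
  by (rule sum.mono_neutral_left) (use assms in \<open>auto simp: in_keys_iff\<close>)

lemma contract_single [simp]:
  "contract scale \<phi> (Poly_Mapping.single p t) = scale (t * \<phi> (fst p)) (snd p)"
  by (subst contract_superset[of "{p}"]) auto

lemma linear_contract: "Vector_Spaces.linear formal_scale scale (contract scale \<phi>)"
proof unfold_locales
  fix x y :: "('a, 'b) formal"
  let ?A = "Poly_Mapping.keys x \<union> Poly_Mapping.keys y"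
  show "contract scale \<phi> (x + y) = contract scale \<phi> x + contract scale \<phi> y"
    by (subst (1 2 3) contract_superset[of ?A])
      (use Poly_Mapping.keys_add[of x y] in
        \<open>auto simp: lookup_add distrib_right scale_left_distrib sum.distrib\<close>)
next
  fix t :: 'a and x :: "('a, 'b) formal"
  show "contract scale \<phi> (formal_scale t x) = scale t (contract scale \<phi> x)"
    by (subst (1 2) contract_superset[of "Poly_Mapping.keys x"])
      (auto simp: lookup_formal_scale in_keys_iff scale_sum_right mult.assoc)
qed

text \<open>The assignment of \<open>\<phi>(a) b\<close> to \<open>(a, b)\<close> is bilinear, so it
  respects every generating relation and hence their span.\<close>

lemma contract_kernel:
  assumes "Vector_Spaces.linear scale (*) \<phi>" and "x \<in> tensor_kernel scale"
  shows "contract scale \<phi> x = 0"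
proof -
  interpret \<phi>: Vector_Spaces.linear scale "(*)" \<phi> by fact
  interpret c: Vector_Spaces.linear formal_scale scale "contract scale \<phi>"
    by (rule linear_contract)
  show ?thesis
  proof (rule c.eq_0_on_span[where b = "bilinear_relations scale"])
    show "x \<in> formal.span (bilinear_relations scale)"
      using assms(2) by (simp add: tensor_kernel_def)
    fix y assume "y \<in> bilinear_relations scale"
    then show "contract scale \<phi> y = 0"
      by (auto simp: bilinear_relations_def c.diff \<phi>.add \<phi>.scale scale_left_distrib
          scale_right_distrib mult.commute)
  qed
qed

text \<open>Contraction with the coordinate functional of \<open>b\<close> isolates
  \<open>f b\<close>.\<close>

lemma independent_coeff_zero:
  assumes "independent B" "finite F" "F \<subseteq> B"
    and "(\<Sum>b\<in>F. Poly_Mapping.single (b, f b) 1) \<in> tensor_kernel scale" and "b \<in> F"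
  shows "f b = 0"
proof -
  \<comment> \<open>\<open>representation\<close> is 0 outside the span of its basis, so coordinates
    with respect to \<open>B\<close> need not be linear on the whole space. Extending
    \<open>B\<close> to a full basis makes the coordinate functional linear everywhere.\<close>
  let ?E = "extend_basis B"
  let ?\<phi> = "\<lambda>v. representation ?E v b"
  note E = independent_extend_basis[OF assms(1)] span_extend_basis[OF assms(1)]
  have "Vector_Spaces.linear scale (*) ?\<phi>"
    by unfold_locales
      (auto simp: E representation_add representation_scale algebra_simps)
  then have "contract scale ?\<phi> (\<Sum>b\<in>F. Poly_Mapping.single (b, f b) 1) = 0"
    using assms(4) by (rule contract_kernel)
  moreover interpret c: Vector_Spaces.linear formal_scale scale "contract scale ?\<phi>"
    by (rule linear_contract)
  have "b' \<in> ?E" if "b' \<in> F" for b'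
    using that assms(3) extend_basis_superset[OF assms(1)] by auto
  ultimately have "(\<Sum>b'\<in>F. scale (if b = b' then 1 else 0) (f b')) = 0"
    by (simp add: c.sum representation_basis E)
  also have "(\<Sum>b'\<in>F. scale (if b = b' then 1 else 0) (f b')) = (\<Sum>b'\<in>F. if b = b' then f b' else 0)"
    by (rule sum.cong) auto
  finally show ?thesis using assms(2,5) by simp
qed

lemma expand_left_factor:
  assumes "independent B" "Poly_Mapping.keys x \<subseteq> span B \<times> UNIV"
  obtains F f where "finite F" "F \<subseteq> B"
    "x - (\<Sum>b\<in>F. Poly_Mapping.single (b, f b) 1) \<in> tensor_kernel scale"
proof -
  let ?r = "\<lambda>p b. representation B (fst p) b"
  let ?l = "Poly_Mapping.lookup x"
  let ?K = "Poly_Mapping.keys x"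
  \<comment> \<open>\<open>F\<close> collects the basis vectors occurring in some left factor of
    \<open>x\<close>; \<open>f b\<close> gathers the right factors, weighted by the coordinate at
    \<open>b\<close> of the left factor and by the coefficient in \<open>x\<close>.\<close>
  define F where "F = (\<Union>p\<in>?K. {b. ?r p b \<noteq> 0})"
  define f where "f b = (\<Sum>p\<in>?K. scale (?l p * ?r p b) (snd p))" for b
  have F: "finite F" "F \<subseteq> B"
    by (auto simp: F_def finite_representation dest: representation_ne_zero)
  have expand: "Poly_Mapping.single p (?l p)
      - (\<Sum>b\<in>F. Poly_Mapping.single (b, scale (?l p * ?r p b) (snd p)) 1) \<in> tensor_kernel scale"
    if p: "p \<in> ?K" for p
  proof -
    have "fst p \<in> span B" using assms(2) p by auto
    then have "fst p = (\<Sum>b | ?r p b \<noteq> 0. scale (?r p b) b)"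
      using sum_nonzero_representation_eq[OF assms(1)] by simp
    also have "\<dots> = (\<Sum>b\<in>F. scale (?r p b) b)"
      by (rule sum.mono_neutral_left) (use F p in \<open>auto simp: F_def\<close>)
    finally have fst_p: "(\<Sum>b\<in>F. scale (?r p b) b) = fst p" ..
    \<comment> \<open>The coordinates migrate across the tensor sign: \<open>1\<close> splits the
      left factor, \<open>2\<close> turns its coordinates into coefficients, and \<open>3\<close>,
      read backwards, absorbs all coefficients into the right factor.\<close>
    have 1: "Poly_Mapping.single p (?l p)
        - (\<Sum>b\<in>F. Poly_Mapping.single (scale (?r p b) b, snd p) (?l p)) \<in> tensor_kernel scale"
      using single_sum_left_kernel[of "\<lambda>b. scale (?r p b) b" F "snd p" "?l p" scale]
      by (simp add: fst_p)
    have 2: "(\<Sum>b\<in>F. Poly_Mapping.single (scale (?r p b) b, snd p) (?l p))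
        - (\<Sum>b\<in>F. Poly_Mapping.single (b, snd p) (?l p * ?r p b)) \<in> tensor_kernel scale"
      by (subst sum_subtractf[symmetric], rule kernel_sum) (rule single_scale_left_kernel)
    have 3: "(\<Sum>b\<in>F. Poly_Mapping.single (b, scale (?l p * ?r p b) (snd p)) 1)
        - (\<Sum>b\<in>F. Poly_Mapping.single (b, snd p) (?l p * ?r p b)) \<in> tensor_kernel scale"
      by (subst sum_subtractf[symmetric], rule kernel_sum)
        (use single_scale_right_kernel[where t = 1 and smul = scale] in simp)
    show ?thesis using kernel_diff[OF kernel_add[OF 1 2] 3] by simp
  qed
  have x: "x - (\<Sum>p\<in>?K. \<Sum>b\<in>F. Poly_Mapping.single (b, scale (?l p * ?r p b) (snd p)) 1)
      \<in> tensor_kernel scale"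
    by (subst (1) formal_eq_sum_single[of x], subst sum_subtractf[symmetric], rule kernel_sum)
      (rule expand)
  have f: "(\<Sum>b\<in>F. Poly_Mapping.single (b, f b) 1)
      - (\<Sum>p\<in>?K. \<Sum>b\<in>F. Poly_Mapping.single (b, scale (?l p * ?r p b) (snd p)) 1)
      \<in> tensor_kernel scale"
    unfolding f_def
    by (subst sum.swap, subst sum_subtractf[symmetric], rule kernel_sum)
      (rule single_sum_right_kernel)
  have "x - (\<Sum>b\<in>F. Poly_Mapping.single (b, f b) 1) \<in> tensor_kernel scale"
    using kernel_diff[OF x f] by simp
  then show thesis using that F by blast
qed

text \<open>The elements of \<open>S \<otimes> V\<close> killed by all \<open>1 \<otimes> D\<close> form \<open>S \<otimes> \<Inter>ker D\<close>: expand the left factor in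
  a basis of \<open>S\<close>, whose coefficients are then killed by every \<open>D\<close>.\<close>

lemma keys_in_common_kernel:
  assumes "subspace S" "Poly_Mapping.keys x \<subseteq> S \<times> UNIV"
    and D: "\<And>u. Vector_Spaces.linear scale scale (D u)"
    and ker: "\<And>u. formal_map (map_prod id (D u)) x \<in> tensor_kernel scale"
  obtains y where "x - y \<in> tensor_kernel scale" "Poly_Mapping.keys y \<subseteq> S \<times> {v. \<forall>u. D u v = 0}"
proof -
  obtain B where B: "B \<subseteq> S" "independent B" "S \<subseteq> span B"
    using maximal_independent_subset[of S] by blast
  then have "Poly_Mapping.keys x \<subseteq> span B \<times> UNIV" using assms(2) by auto
  then obtain F f where F: "finite F" "F \<subseteq> B"
    and x: "x - (\<Sum>b\<in>F. Poly_Mapping.single (b, f b) 1) \<in> tensor_kernel scale" (is "x - ?y \<in> _")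
    by (rule expand_left_factor[OF B(2)])
  have "D u (f b) = 0" if "b \<in> F" for u b
  proof (rule independent_coeff_zero[OF B(2) F _ that])
    have "formal_map (map_prod id (D u)) x - formal_map (map_prod id (D u)) ?y
        \<in> tensor_kernel scale"
      unfolding formal_map_diff[symmetric] by (rule formal_map_kernel[OF linear_id D x])
    then have "formal_map (map_prod id (D u)) ?y \<in> tensor_kernel scale"
      using ker kernel_diff_iff by blast
    then show "(\<Sum>b\<in>F. Poly_Mapping.single (b, D u (f b)) 1) \<in> tensor_kernel scale"
      by (simp add: formal_map_sum)
  qed
  then have "Poly_Mapping.keys ?y \<subseteq> S \<times> {v. \<forall>u. D u v = 0}"
    using F B(1) by (intro order.trans[OF Poly_Mapping.keys_sum]) (auto split: if_splits)
  with x show thesis by (rule that)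
qed

end

section \<open>The Lie algebra action\<close>

text \<open>Two separate acting elements are allowed because an element of the direct sum acts on
  the two factors of an off-diagonal block through different components. The diagonal adjoint action
  is the case \<open>u = v\<close>.\<close>

definition formal_act :: "('a \<Rightarrow> 'a \<Rightarrow> 'a) \<Rightarrow> 'a \<Rightarrow> 'a \<Rightarrow> ('k::field, 'a) formal \<Rightarrow> ('k, 'a) formal" where
  "formal_act bracket u v x =
     formal_map (map_prod (bracket u) id) x + formal_map (map_prod id (bracket v)) x"

context lie_algebra
begin

lemma bracket_0_left [simp]: "bracket 0 x = 0"
  using bracket_add_left[of 0 0 x] by simp

lemma bracket_0_right [simp]: "bracket x 0 = 0"
  using bracket_add_right[of x 0 0] by simp

lemma linear_bracket: "Vector_Spaces.linear smul smul (bracket x)"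
  by unfold_locales (auto simp: bracket_add_right bracket_scale_right)

lemma subspace_center: "subspace (lie_center bracket)"
  by (auto simp: subspace_def lie_center_def bracket_add_right bracket_scale_right)

lemma formal_act_kernel: "x \<in> tensor_kernel smul \<Longrightarrow> formal_act bracket u v x \<in> tensor_kernel smul"
  unfolding formal_act_def
  by (intro kernel_add formal_map_kernel[OF linear_bracket linear_id]
      formal_map_kernel[OF linear_id linear_bracket])

lemma lie_invariant_class:
  "lie_invariant smul bracket (tensor_class smul x) \<longleftrightarrow>
    (\<forall>u. formal_act bracket u u x \<in> tensor_kernel smul)"
  by (simp add: lie_invariant_def ad_tensor_def tensor_zero_def formal_act_def tensor_add_class
      tensor_map_class[OF linear_bracket linear_id] tensor_map_class[OF linear_id linear_bracket]
      tensor_class_eq_iff)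

text \<open>Brackets annihilate central factors, which gives one direction. For the other, each
  factor is made central in turn by \<open>keys_in_common_kernel\<close>, with a flip in
  between.\<close>

lemma class_in_center_iff:
  "tensor_class smul x \<in> tensor_subspaces smul (lie_center bracket) (lie_center bracket) \<longleftrightarrow>
    (\<forall>u v. formal_act bracket u v x \<in> tensor_kernel smul)"
proof
  assume "tensor_class smul x \<in> tensor_subspaces smul (lie_center bracket) (lie_center bracket)"
  then obtain y where y: "Poly_Mapping.keys y \<subseteq> lie_center bracket \<times> lie_center bracket"
    and xy: "x - y \<in> tensor_kernel smul"
    by (auto simp: tensor_subspaces_def tensor_class_eq_iff)
  show "\<forall>u v. formal_act bracket u v x \<in> tensor_kernel smul"
  proof (intro allI)
    fix u v
    have "formal_act bracket u v y \<in> tensor_kernel smul"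
      unfolding formal_act_def
      by (intro kernel_add formal_map_zero_kernel) (use y in \<open>auto simp: lie_center_def\<close>)
    moreover have "formal_act bracket u v x - formal_act bracket u v y \<in> tensor_kernel smul"
      using formal_act_kernel[OF xy, of u v]
      by (simp add: formal_act_def formal_map_diff algebra_simps)
    ultimately show "formal_act bracket u v x \<in> tensor_kernel smul"
      by (simp add: kernel_diff_iff)
  qed
next
  assume act: "\<forall>u v. formal_act bracket u v x \<in> tensor_kernel smul"
  let ?Z = "{z. \<forall>x. bracket x z = 0}"
  \<comment> \<open>Setting \<open>u\<close> or \<open>v\<close> to 0 in \<open>act\<close>
    separates the conditions on the two factors.\<close>
  have zero: "formal_map (map_prod (bracket 0) id) y \<in> tensor_kernel smul"
    "formal_map (map_prod id (bracket 0)) y \<in> tensor_kernel smul" for y :: "('k, 'a) formal"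
    by (rule formal_map_zero_kernel; simp)+
  have right: "formal_map (map_prod id (bracket v)) x \<in> tensor_kernel smul" for v
    using kernel_diff[OF act[rule_format, of 0 v] zero(1)[of x]] by (simp add: formal_act_def)
  have left: "formal_map (map_prod (bracket u) id) x \<in> tensor_kernel smul" for u
    using kernel_diff[OF act[rule_format, of u 0] zero(2)[of x]] by (simp add: formal_act_def)
  obtain y where xy: "x - y \<in> tensor_kernel smul" and y: "Poly_Mapping.keys y \<subseteq> UNIV \<times> ?Z"
    using keys_in_common_kernel[where D = bracket, OF subspace_UNIV _ linear_bracket right]
    by auto
  have "formal_map (map_prod (bracket u) id) y \<in> tensor_kernel smul" for u
    using kernel_diff_iff[OF formal_map_kernel[OF linear_bracket linear_id xy, of u,
          unfolded formal_map_diff]] left by simp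
  then have ker: "formal_map (map_prod id (bracket u)) (formal_map prod.swap y)
      \<in> tensor_kernel smul" for u
    unfolding formal_map_swap_map_prod[symmetric] by (rule formal_map_swap_kernel)
  \<comment> \<open>After the flip the central factor stands on the left. The second application
    takes the subspace \<open>S\<close> to be the center, so this centrality survives while the
    other factor becomes central.\<close>
  have keys: "Poly_Mapping.keys (formal_map prod.swap y) \<subseteq> ?Z \<times> UNIV"
    using y by (intro order.trans[OF keys_formal_map_subset]) auto
  obtain w where yw: "formal_map prod.swap y - w \<in> tensor_kernel smul"
    and w: "Poly_Mapping.keys w \<subseteq> ?Z \<times> ?Z"
    by (rule keys_in_common_kernel[where D = bracket,
        OF subspace_center[unfolded lie_center_def] keys linear_bracket ker])
  have "x - formal_map prod.swap w \<in> tensor_kernel smul"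
    using kernel_add[OF xy formal_map_swap_kernel[OF yw]] by (simp add: formal_map_diff)
  then have "tensor_class smul x = tensor_class smul (formal_map prod.swap w)"
    by (simp add: tensor_class_eq_iff)
  moreover have "Poly_Mapping.keys (formal_map prod.swap w) \<subseteq> ?Z \<times> ?Z"
    using w by (intro order.trans[OF keys_formal_map_subset]) auto
  ultimately show
    "tensor_class smul x \<in> tensor_subspaces smul (lie_center bracket) (lie_center bracket)"
    unfolding tensor_subspaces_def lie_center_def by blast
qed

section \<open>Block decomposition over the direct sum\<close>

lemma linear_axis: "Vector_Spaces.linear smul (dsum_scale smul) (axis i :: 'a \<Rightarrow> 'a ^ 'n)"
proof -
  interpret d: lie_algebra "dsum_scale smul :: 'k \<Rightarrow> 'a ^ 'n \<Rightarrow> 'a ^ 'n" "dsum_bracket bracket"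
    by (rule lie_algebra_dsum) unfold_locales
  show ?thesis by unfold_locales (auto simp: axis_def vec_eq_iff dsum_scale_def)
qed

lemma linear_component: "Vector_Spaces.linear (dsum_scale smul) smul (\<lambda>v :: 'a ^ 'n. v $ i)"
proof -
  interpret d: lie_algebra "dsum_scale smul :: 'k \<Rightarrow> 'a ^ 'n \<Rightarrow> 'a ^ 'n" "dsum_bracket bracket"
    by (rule lie_algebra_dsum) unfold_locales
  show ?thesis by unfold_locales (auto simp: dsum_scale_def)
qed

text \<open>Bracketing with \<open>X\<close> after the \<open>k\<close>-th inclusion is the
  \<open>k\<close>-th inclusion after bracketing with \<open>X $ k\<close>.\<close>

lemma formal_act_dsum_axis:
  "formal_act (dsum_bracket bracket) X X (formal_map (map_prod (axis j) (axis i)) x) =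
    formal_map (map_prod (axis j) (axis i)) (formal_act bracket (X $ j) (X $ i) x)"
proof -
  have "dsum_bracket bracket X \<circ> axis k = axis k \<circ> bracket (X $ k)" for k
    by (auto simp: dsum_bracket_def axis_def vec_eq_iff)
  then show ?thesis
    by (simp add: formal_act_def formal_map_add formal_map_comp map_prod.comp)
qed

lemma formal_sum_blocks_kernel_iff:
  fixes w :: "'n::finite \<Rightarrow> 'n \<Rightarrow> ('k, 'a) formal"
  shows "(\<Sum>(i, j)\<in>UNIV. formal_map (map_prod (axis j) (axis i)) (w i j))
      \<in> tensor_kernel (dsum_scale smul :: 'k \<Rightarrow> 'a ^ 'n \<Rightarrow> _) \<longleftrightarrow>
    (\<forall>i j. w i j \<in> tensor_kernel smul)"
proof
  let ?W = "\<Sum>(i, j)\<in>UNIV. formal_map (map_prod (axis j) (axis i)) (w i j)"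
  assume W: "?W \<in> tensor_kernel (dsum_scale smul)"
  show "\<forall>i j. w i j \<in> tensor_kernel smul"
  proof (intro allI)
    fix i j
    let ?p = "\<lambda>k (v :: 'a ^ 'n). v $ k"
    let ?P = "formal_map (map_prod (?p j) (?p i)) :: ('k, 'a ^ 'n) formal \<Rightarrow> ('k, 'a) formal"
    \<comment> \<open>The projection \<open>?P\<close> inverts the inclusion of the block at
      \<open>(i, j)\<close>; on any other block at least one component map composes with its
      inclusion to 0.\<close>
    let ?T = "\<lambda>q. ?P (formal_map (map_prod (axis (snd q)) (axis (fst q))) (w (fst q) (snd q)))"
    have "?p k \<circ> axis k = id" for k
      by (auto simp: axis_def)
    then have T_ij: "?T (i, j) = w i j"
      by (simp add: formal_map_comp map_prod.comp map_prod.id)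
    have "?T q \<in> tensor_kernel smul" if "q \<noteq> (i, j)" for q
      unfolding formal_map_comp map_prod.comp
      by (rule formal_map_zero_kernel) (use that in \<open>auto simp: axis_def prod_eq_iff\<close>)
    then have rest: "(\<Sum>q\<in>UNIV - {(i, j)}. ?T q) \<in> tensor_kernel smul"
      by (intro kernel_sum) auto
    have "?P ?W = ?T (i, j) + (\<Sum>q\<in>UNIV - {(i, j)}. ?T q)"
      by (subst sum.remove[symmetric]) (simp_all add: formal_map_sum case_prod_unfold)
    then have "w i j = ?P ?W - (\<Sum>q\<in>UNIV - {(i, j)}. ?T q)"
      unfolding T_ij by simp
    then show "w i j \<in> tensor_kernel smul"
      using kernel_diff[OF formal_map_kernel[OF linear_component linear_component W] rest]
      by (simp only:)
  qed
next
  assume w: "\<forall>i j. w i j \<in> tensor_kernel smul"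
  have "(case q of (i, j) \<Rightarrow> formal_map (map_prod (axis j) (axis i)) (w i j))
      \<in> tensor_kernel (dsum_scale smul :: 'k \<Rightarrow> 'a ^ 'n \<Rightarrow> _)" for q
    using formal_map_kernel[OF linear_axis linear_axis w[rule_format]] by (simp add: split_def)
  then show "(\<Sum>(i, j)\<in>UNIV. formal_map (map_prod (axis j) (axis i)) (w i j))
      \<in> tensor_kernel (dsum_scale smul :: 'k \<Rightarrow> 'a ^ 'n \<Rightarrow> _)"
    by (rule kernel_sum)
qed

end

theorem lemma4p11:
  fixes smul :: "'k::field_char_0 \<Rightarrow> 'g::ab_group_add \<Rightarrow> 'g"
    and bracket :: "'g \<Rightarrow> 'g \<Rightarrow> 'g"
    and C :: "'c set"
    and r :: "'c \<Rightarrow> ('k, 'g) tensor"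
    and c :: "'n::{finite,linorder} \<Rightarrow> 'n \<Rightarrow> 'c"
  assumes "lie_algebra smul bracket"
    and "\<And>d. d \<in> C \<Longrightarrow> r d \<in> tensor_space smul"
    and "\<And>d. d \<in> C \<Longrightarrow>
           lie_invariant smul bracket (tensor_add smul (r d) (tensor_flip smul (r d)))"
    and "\<And>i j. c i j \<in> C"
  shows "lie_invariant (dsum_scale smul) (dsum_bracket bracket)
           (tensor_add (dsum_scale smul)
              (r_family smul r c) (tensor_flip (dsum_scale smul) (r_family smul r c)))
         \<longleftrightarrow> (\<forall>i k. i < k \<longrightarrow>
               tensor_add smul (r (c i k)) (tensor_flip smul (r (c k i)))
                 \<in> tensor_subspaces smul (lie_center bracket) (lie_center bracket))"
proof -
  interpret lie_algebra smul bracket by fact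
  interpret d: lie_algebra "dsum_scale smul :: 'k \<Rightarrow> ('g, 'n) vec \<Rightarrow> _" "dsum_bracket bracket"
    by (rule lie_algebra_dsum) fact
  define x where "x i j = tensor_rep (r (c i j))" for i j
  define t where "t i j = x i j + formal_map prod.swap (x j i)" for i j
  let ?Z = "tensor_subspaces smul (lie_center bracket) (lie_center bracket)"
  let ?\<iota> = "\<lambda>i j. formal_map (map_prod (axis j) (axis i)) ::
    ('k, 'g) formal \<Rightarrow> ('k, ('g, 'n) vec) formal"
  have r: "r (c i j) = tensor_class smul (x i j)" for i j
    unfolding x_def using assms(2,4) by (simp add: tensor_class_rep)
  have t: "tensor_add smul (r (c i j)) (tensor_flip smul (r (c j i))) = tensor_class smul (t i j)"
    for i j
    by (simp add: r t_def tensor_flip_class tensor_add_class)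
  have "r_family smul r c = tensor_class (dsum_scale smul) (\<Sum>(i, j)\<in>UNIV. ?\<iota> i j (x i j))"
    by (simp add: r_family_def two_block_place_def r tensor_map_class[OF linear_axis linear_axis]
        case_prod_unfold tensor_sum_class)
  moreover have "formal_map prod.swap (\<Sum>(i, j)\<in>UNIV. ?\<iota> i j (x i j)) =
      (\<Sum>(i, j)\<in>UNIV. ?\<iota> i j (formal_map prod.swap (x j i)))"
    \<comment> \<open>The flip exchanges the blocks at \<open>(i, j)\<close> and
      \<open>(j, i)\<close>, so the sum is reindexed by swapping the pair.\<close>
    unfolding formal_map_sum
    by (rule sum.reindex_bij_witness[of _ prod.swap prod.swap])
      (auto simp: formal_map_swap_map_prod)
  ultimately have R: "tensor_add (dsum_scale smul) (r_family smul r c)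
      (tensor_flip (dsum_scale smul) (r_family smul r c)) =
      tensor_class (dsum_scale smul) (\<Sum>(i, j)\<in>UNIV. ?\<iota> i j (t i j))"
    by (simp add: tensor_flip_class tensor_add_class t_def formal_map_add case_prod_unfold
        sum.distrib)
  have "formal_act (dsum_bracket bracket) X X (\<Sum>(i, j)\<in>UNIV. ?\<iota> i j (t i j)) =
      (\<Sum>(i, j)\<in>UNIV. ?\<iota> i j (formal_act bracket (X $ j) (X $ i) (t i j)))" for X
    unfolding formal_act_dsum_axis[symmetric]
    by (simp add: formal_act_def formal_map_sum sum.distrib case_prod_unfold)
  then have "lie_invariant (dsum_scale smul) (dsum_bracket bracket)
      (tensor_add (dsum_scale smul)
        (r_family smul r c) (tensor_flip (dsum_scale smul) (r_family smul r c))) \<longleftrightarrow>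
      (\<forall>X i j. formal_act bracket ((X :: ('g, 'n) vec) $ j) (X $ i) (t i j) \<in> tensor_kernel smul)"
    by (simp add: R d.lie_invariant_class formal_sum_blocks_kernel_iff)
  also have "\<dots> \<longleftrightarrow> (\<forall>i j. i \<noteq> j \<longrightarrow> (\<forall>u v. formal_act bracket u v (t i j) \<in> tensor_kernel smul))"
  proof (intro iffI allI impI)
    fix i j :: 'n and u v
    assume *: "\<forall>X i j. formal_act bracket ((X :: ('g, 'n) vec) $ j) (X $ i) (t i j)
        \<in> tensor_kernel smul"
      and "i \<noteq> j"
    \<comment> \<open>As \<open>i\<close> and \<open>j\<close> differ, one \<open>X\<close> can have
      component \<open>u\<close> at \<open>j\<close> and \<open>v\<close> at \<open>i\<close>; its
      remaining components do not affect this block.\<close>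
    then show "formal_act bracket u v (t i j) \<in> tensor_kernel smul"
      using *[rule_format, of "\<chi> k. if k = j then u else v" j i] by simp
  next
    fix X :: "('g, 'n) vec" and i j :: 'n
    assume *: "\<forall>i j. i \<noteq> j \<longrightarrow> (\<forall>u v. formal_act bracket u v (t i j) \<in> tensor_kernel smul)"
    \<comment> \<open>\<open>t i i\<close> represents \<open>r (c i i)\<close> plus its own flip,
      and on a diagonal block both factors see the same component of \<open>X\<close>, so the
      assumed invariance applies.\<close>
    have "formal_act bracket u u (t i i) \<in> tensor_kernel smul" for u
      using assms(3)[OF assms(4)[of i i]] by (simp add: t lie_invariant_class)
    with * show "formal_act bracket (X $ j) (X $ i) (t i j) \<in> tensor_kernel smul"
      by (cases "i = j") auto
  qed
  also have "\<dots> \<longleftrightarrow> (\<forall>i j. i \<noteq> j \<longrightarrow> tensor_class smul (t i j) \<in> ?Z)"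
    by (simp add: class_in_center_iff)
  also have "\<dots> \<longleftrightarrow> (\<forall>i k. i < k \<longrightarrow> tensor_class smul (t i k) \<in> ?Z)"
  proof -
    \<comment> \<open>\<open>?Z\<close> is stable under the flip, which interchanges
      \<open>t i j\<close> and \<open>t j i\<close>; hence one order of each pair is enough.\<close>
    have "tensor_class smul (t j i) \<in> ?Z" if Z: "tensor_class smul (t i j) \<in> ?Z" for i j
    proof -
      obtain y where y: "tensor_class smul (t i j) = tensor_class smul y"
        "Poly_Mapping.keys y \<subseteq> lie_center bracket \<times> lie_center bracket"
        using Z unfolding tensor_subspaces_def by blast
      have "t j i = formal_map prod.swap (t i j)"
        by (simp add: t_def formal_map_add add.commute)
      then have "tensor_class smul (t j i) = tensor_class smul (formal_map prod.swap y)"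
        using y(1) by (metis tensor_flip_class)
      moreover have "Poly_Mapping.keys (formal_map prod.swap y)
          \<subseteq> lie_center bracket \<times> lie_center bracket"
        using y(2) by (intro order.trans[OF keys_formal_map_subset]) auto
      ultimately show ?thesis by (auto simp: tensor_subspaces_def)
    qed
    then show ?thesis by (auto simp: neq_iff)
  qed
  finally show ?thesis by (simp add: t)
qed

end
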